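(* Let $G$ be a digraph with $v$ vertices and let $\Gamma$ be a transitive subtournament of size $s$ in $G$. Let $\alpha=\max\{\theta:\theta\in M(G)\}$ and $\gamma=\max\{\theta:\theta\in\mathrm{ev}(G)\setminus M(G)\}$ (where $\mathrm{ev}(G)\setminus M(G)$ is assumed nonempty, so that $\gamma$ is defined). If $\alpha\le\gamma$, then $$s\le \frac{3\alpha^2-3\gamma^2+\sqrt{4v^2(1+3\gamma^2)+9(\gamma^2-\alpha^2)^2}}{2v}.$$
   Context: A digraph $G=(V,E)$ has a finite vertex set $V=V(G)$ and edge set $E\subseteq V\times V$. Its adjacency matrix $A$ is the $V\times V$ matrix with $A_{x,y}=1$ if $(x,y)\in E$ and $A_{x,y}=0$ otherwise. The Seidel matrix of $G$ is the Hermitian matrix $S_G=\sqrt{-1}(A-A^\top)$; its eigenvalues are real. $\mathrm{ev}(G)$ denotes the set of distinct eigenvalues of $S_G$, and $E_\theta$ denotes the orthogonal projection matrix onto the eigenspace of $S_G$ for $\theta\in\mathrm{ev}(G)$. With $\mathbf{1}$ the all-one vector of length $v$, the main angle of $\theta$ is $\beta_\theta=\frac{1}{\sqrt v}\|E_\theta\mathbf{1}\|$, and $M(G)=\{\theta\in\mathrm{ev}(G):\beta_\theta\neq 0\}$ is the set of main eigenvalues. A tournament is a digraph with $A+A^\top=J-I$ ($J$ the all-one matrix, $I$ the identity). A transitive tournament is a tournament such that $(x,y)\in E$ and $(y,z)\in E$ imply $(x,z)\in E$. A transitive subtournament of size $s$ in $G$ is an induced sub-digraph of $G$ on $s$ vertices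 which is a transitive tournament. *)

theory Defs
  imports "HOL-Analysis.Analysis" "Graph_Theory.Digraph_Component" "Graph_Theory.Pair_Digraph"
begin

section \<open>Digraphs and transitive tournaments\<close>

text \<open>
  A digraph \<open>(V, E)\<close> with \<open>E \<subseteq> V \<times> V\<close> is a \<open>pair_fin_digraph\<close>; loops and pairs of opposite
  arcs are allowed.
\<close>

definition adjacency :: "'v pair_pre_digraph \<Rightarrow> 'v \<Rightarrow> 'v \<Rightarrow> complex" where
  "adjacency G x y = (if (x, y) \<in> parcs G then 1 else 0)"

text \<open>The condition \<open>A + A\<^sup>T = J - I\<close>, entrywise on the vertex set.\<close>

definition tournament :: "'v pair_pre_digraph \<Rightarrow> bool" where
  "tournament G \<longleftrightarrow> pair_fin_digraph G \<and>
     (\<forall>x\<in>pverts G. \<forall>y\<in>pverts G.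
        adjacency G x y + adjacency G y x = 1 - (if x = y then 1 else 0))"

definition transitive_tournament :: "'v pair_pre_digraph \<Rightarrow> bool" where
  "transitive_tournament G \<longleftrightarrow> tournament G \<and> trans (parcs G)"

definition transitive_subtournament :: "'v pair_pre_digraph \<Rightarrow> 'v pair_pre_digraph \<Rightarrow> bool" where
  "transitive_subtournament \<Gamma> G \<longleftrightarrow>
     induced_subgraph (with_proj \<Gamma>) (with_proj G) \<and> transitive_tournament \<Gamma>"

section \<open>Eigenspaces and orthogonal projections\<close>

definition hermitian_transpose :: "complex^'n^'m \<Rightarrow> complex^'m^'n" where
  "hermitian_transpose A = (\<chi> i j. cnj (A $ j $ i))"

definition eigenspace :: "complex^'n^'n \<Rightarrow> complex \<Rightarrow> (complex^'n) set" where
  "eigenspace A \<theta> = {x. A *v x = \<theta> *s x}"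

definition eigenvalue :: "complex^'n^'n \<Rightarrow> complex \<Rightarrow> bool" where
  "eigenvalue A \<theta> \<longleftrightarrow> (\<exists>x. x \<noteq> 0 \<and> A *v x = \<theta> *s x)"

definition is_orthogonal_projection :: "(complex^'n) set \<Rightarrow> complex^'n^'n \<Rightarrow> bool" where
  "is_orthogonal_projection U P \<longleftrightarrow>
     P ** P = P \<and> hermitian_transpose P = P \<and> range ((*v) P) = U"

text \<open>Well-defined for every complex subspace \<open>U\<close>; see \<open>ex1_orthogonal_projection\<close> below.\<close>

definition orthogonal_projection :: "(complex^'n) set \<Rightarrow> complex^'n^'n" where
  "orthogonal_projection U = (THE P. is_orthogonal_projection U P)"

section \<open>The Seidel matrix and main eigenvalues\<close>

text \<open>
  The vertex set is the whole finite type \<open>'v\<close>, so that \<open>V \<times> V\<close> matrices are matrices indexed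
  by \<open>'v\<close> and \<open>v = CARD('v)\<close>.
\<close>

definition adjacency_matrix :: "'v::finite pair_pre_digraph \<Rightarrow> complex^'v^'v" where
  "adjacency_matrix G = (\<chi> x y. adjacency G x y)"

definition seidel_matrix :: "'v::finite pair_pre_digraph \<Rightarrow> complex^'v^'v" where
  "seidel_matrix G =
     (\<chi> x y. \<i> * (adjacency_matrix G - transpose (adjacency_matrix G)) $ x $ y)"

text \<open>
  The eigenvalues are collected as real numbers; no eigenvalue is lost, by
  \<open>seidel_eigenvalue_real\<close> below.
\<close>

definition ev :: "'v::finite pair_pre_digraph \<Rightarrow> real set" where
  "ev G = {\<theta>. eigenvalue (seidel_matrix G) (complex_of_real \<theta>)}"

definition eigenprojection :: "'v::finite pair_pre_digraph \<Rightarrow> real \<Rightarrow> complex^'v^'v" where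
  "eigenprojection G \<theta> =
     orthogonal_projection (eigenspace (seidel_matrix G) (complex_of_real \<theta>))"

definition main_angle :: "'v::finite pair_pre_digraph \<Rightarrow> real \<Rightarrow> real" where
  "main_angle G \<theta> = norm (eigenprojection G \<theta> *v (\<chi> x. 1)) / sqrt (real CARD('v))"

definition main_ev :: "'v::finite pair_pre_digraph \<Rightarrow> real set" where
  "main_ev G = {\<theta> \<in> ev G. main_angle G \<theta> \<noteq> 0}"

section \<open>Well-definedness\<close>

definition hdot :: "complex^'n \<Rightarrow> complex^'n \<Rightarrow> complex" where
  "hdot x y = (\<Sum>i\<in>UNIV. x $ i * cnj (y $ i))"

lemma inner_eq_Re_hdot: "x \<bullet> y = Re (hdot x y)" for x y :: "complex^'n"
  by (simp add: hdot_def inner_vec_def inner_complex_def)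

lemma hdot_add: "hdot (x + y) z = hdot x z + hdot y z" "hdot z (x + y) = hdot z x + hdot z y"
  and hdot_diff: "hdot (x - y) z = hdot x z - hdot y z" "hdot z (x - y) = hdot z x - hdot z y"
  and hdot_scale: "hdot (c *s x) z = c * hdot x z" "hdot z (c *s x) = cnj c * hdot z x"
  by (simp_all add: hdot_def sum.distrib sum_subtractf sum_distrib_left algebra_simps)

lemma hdot_self_eq_0: "hdot x x = 0 \<longleftrightarrow> x = 0" for x :: "complex^'n"
  by (metis inner_eq_Re_hdot inner_eq_zero_iff zero_complex.sel(1) hdot_scale(1) vector_smult_lzero mult_zero_left)

lemma hdot_axis: "hdot x (axis i 1) = x $ i" "hdot (axis i 1) x = cnj (x $ i)"
  by (simp_all add: hdot_def axis_def if_distrib if_distribR cong: if_cong)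

lemma hdot_cnj: "cnj (hdot x y) = hdot y x"
  by (simp add: hdot_def mult.commute)

lemma hermitian_transpose_mult:
  "hermitian_transpose (A ** B) = hermitian_transpose B ** hermitian_transpose A"
  by (simp add: hermitian_transpose_def matrix_matrix_mult_def vec_eq_iff mult.commute)

lemma hdot_matrix: "hdot (A *v x) y = hdot x (hermitian_transpose A *v y)"
proof -
  have "hdot (A *v x) y = (\<Sum>i\<in>UNIV. \<Sum>j\<in>UNIV. A $ i $ j * x $ j * cnj (y $ i))"
    by (simp add: hdot_def matrix_vector_mult_def sum_distrib_right)
  also have "\<dots> = (\<Sum>j\<in>UNIV. \<Sum>i\<in>UNIV. A $ i $ j * x $ j * cnj (y $ i))"
    by (rule sum.swap)
  also have "\<dots> = hdot x (hermitian_transpose A *v y)"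
    by (simp add: hdot_def hermitian_transpose_def matrix_vector_mult_def sum_distrib_left mult_ac)
  finally show ?thesis .
qed

lemma ex1_orthogonal_projection:
  fixes U :: "(complex^'n) set"
  assumes U: "vec.subspace U"
  shows "\<exists>!P. is_orthogonal_projection U P"
proof (rule ex_ex1I)
  have "subspace U"
  proof -
    have "c *\<^sub>R x = complex_of_real c *s x" for c and x :: "complex^'n"
      by (simp add: vec_eq_iff scaleR_conv_of_real[where 'a=complex])
    with U show ?thesis unfolding subspace_def vec.subspace_def by auto
  qed
  then have span: "span U = U" by (simp add: span_eq_iff)
  have ex: "\<exists>u. u \<in> U \<and> (\<forall>w\<in>U. hdot (x - u) w = 0)" for x
  proof -
    obtain y z where yz: "y \<in> span U" "\<And>w. w \<in> span U \<Longrightarrow> orthogonal z w" "x = y + z"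
      using orthogonal_subspace_decomp_exists[of U x] by blast
    have "hdot z w = 0" if "w \<in> U" for w
    proof -
      have "\<i> *s w \<in> U" using U that unfolding vec.subspace_def by blast
      then have "z \<bullet> w = 0" "z \<bullet> (\<i> *s w) = 0"
        using yz(2) that span by (auto simp: orthogonal_def)
      then show ?thesis by (simp add: inner_eq_Re_hdot hdot_scale complex_eq_iff)
    qed
    with yz span show ?thesis by (intro exI[of _ y]) auto
  qed
  then obtain p where pU: "\<And>x. p x \<in> U" and p: "\<And>x w. w \<in> U \<Longrightarrow> hdot (x - p x) w = 0"
    by metis
  have uniq: "u = p x" if "u \<in> U" and "\<And>w. w \<in> U \<Longrightarrow> hdot (x - u) w = 0" for x u
  proof -
    have "p x - u \<in> U" using U pU that(1) by (rule vec.subspace_diff)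
    moreover have "hdot (p x - u) w = hdot (x - u) w - hdot (x - p x) w" for w
      by (simp add: hdot_diff)
    ultimately have "hdot (p x - u) (p x - u) = 0" using that p by simp
    then show ?thesis by (simp add: hdot_self_eq_0)
  qed
  have "Vector_Spaces.linear (*s) (*s) p"
  proof (unfold_locales)
    show "p (x + y) = p x + p y" for x y
    proof (rule uniq[symmetric])
      show "p x + p y \<in> U" using U pU by (simp add: vec.subspace_add)
      show "hdot (x + y - (p x + p y)) w = 0" if "w \<in> U" for w
        using p[OF that, of x] p[OF that, of y] by (simp add: hdot_add hdot_diff)
    qed
    show "p (c *s x) = c *s p x" for c x
    proof (rule uniq[symmetric])
      show "c *s p x \<in> U" using U pU by (simp add: vec.subspace_scale)
      show "hdot (c *s x - c *s p x) w = 0" if "w \<in> U" for w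
        using p[OF that, of x] by (simp add: hdot_scale hdot_diff)
    qed
  qed
  then have M: "matrix p *v x = p x" for x by (rule matrix_works)
  have p_id: "p u = u" if "u \<in> U" for u
    using that by (intro uniq[symmetric]) (simp_all add: hdot_def)
  have idem: "matrix p ** matrix p = matrix p"
    unfolding matrix_eq by (simp add: matrix_vector_mul_assoc[symmetric] M p_id pU)
  have herm: "hdot (p x) y = hdot x (p y)" for x y
  proof -
    have "hdot x (p y) = hdot (p x) (p y)"
      using p[OF pU, of x y] by (simp add: hdot_diff)
    moreover have "cnj (hdot (y - p y) (p x)) = 0" using p[OF pU] by simp
    then have "hdot (p x) y = hdot (p x) (p y)" by (simp add: hdot_cnj hdot_diff)
    ultimately show ?thesis by simp
  qed
  have "hermitian_transpose (matrix p) $ i $ j = matrix p $ i $ j" for i j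
    using herm[of "axis j 1" "axis i 1"]
    by (simp add: hdot_axis hermitian_transpose_def matrix_def)
  then have "hermitian_transpose (matrix p) = matrix p" by (simp add: vec_eq_iff)
  moreover have "range ((*v) (matrix p)) = U" using M p_id pU by (auto simp: image_iff) metis
  ultimately show "\<exists>P. is_orthogonal_projection U P"
    using idem unfolding is_orthogonal_projection_def by blast
next
  fix P Q assume PQ: "is_orthogonal_projection U P" "is_orthogonal_projection U Q"
  have absorb: "A ** B = B" if "is_orthogonal_projection U A" "is_orthogonal_projection U B" for A B
  proof -
    have "A *v (B *v x) = B *v x" for x
    proof -
      have "B *v x \<in> range ((*v) A)" using that unfolding is_orthogonal_projection_def by auto
      then obtain y where "B *v x = A *v y" by auto
      then show ?thesis using that(1)
        by (simp add: matrix_vector_mul_assoc is_orthogonal_projection_def)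
    qed
    then show ?thesis unfolding matrix_eq by (simp add: matrix_vector_mul_assoc[symmetric])
  qed
  have "Q = hermitian_transpose (P ** Q)"
    using absorb[OF PQ] PQ(2) by (simp add: is_orthogonal_projection_def)
  also have "\<dots> = Q ** P"
    using PQ by (simp add: hermitian_transpose_mult is_orthogonal_projection_def)
  also have "\<dots> = P" using absorb PQ by blast
  finally show "P = Q" by simp
qed

lemma subspace_eigenspace: "vec.subspace (eigenspace A \<theta>)"
  by (auto simp: eigenspace_def vec.subspace_def matrix_vector_right_distrib vector_add_ldistrib
      vec.scale vector_smult_assoc mult.commute)

lemma eigenprojection_is_orthogonal_projection:
  "is_orthogonal_projection (eigenspace (seidel_matrix G) (complex_of_real \<theta>)) (eigenprojection G \<theta>)"
  unfolding eigenprojection_def orthogonal_projection_def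
  by (rule theI', rule ex1_orthogonal_projection, rule subspace_eigenspace)

lemma seidel_hermitian: "hermitian_transpose (seidel_matrix G) = seidel_matrix G"
  by (simp add: hermitian_transpose_def seidel_matrix_def adjacency_matrix_def adjacency_def
      transpose_def vec_eq_iff)

lemma seidel_eigenvalue_real:
  assumes "eigenvalue (seidel_matrix G) \<theta>"
  shows "\<theta> \<in> \<real>"
proof -
  obtain x where x: "x \<noteq> 0" "seidel_matrix G *v x = \<theta> *s x"
    using assms unfolding eigenvalue_def by blast
  have "\<theta> * hdot x x = cnj \<theta> * hdot x x"
    using hdot_matrix[of "seidel_matrix G" x x] by (simp add: seidel_hermitian x(2) hdot_scale)
  then show ?thesis using x(1) by (simp add: hdot_self_eq_0 Reals_cnj_iff)
qed

lemma finite_ev: "finite (ev G)"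
proof -
  have "\<forall>\<theta>\<in>ev G. \<exists>x. x \<noteq> 0 \<and> seidel_matrix G *v x = complex_of_real \<theta> *s x"
    by (simp add: ev_def eigenvalue_def)
  then obtain f where f: "\<And>\<theta>. \<theta> \<in> ev G \<Longrightarrow> f \<theta> \<noteq> 0"
      "\<And>\<theta>. \<theta> \<in> ev G \<Longrightarrow> seidel_matrix G *v f \<theta> = complex_of_real \<theta> *s f \<theta>"
    by metis
  have orth: "hdot (f a) (f b) = 0" if "a \<in> ev G" "b \<in> ev G" "a \<noteq> b" for a b
    using hdot_matrix[of "seidel_matrix G" "f a" "f b"] that
    by (simp add: seidel_hermitian f(2) hdot_scale)
  have "inj_on f (ev G)"
    using orth f(1) by (metis inj_onI hdot_self_eq_0)
  moreover have "finite (f ` ev G)"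
  proof (rule pairwise_orthogonal_imp_finite)
    have "f a \<bullet> f b = 0" if "a \<in> ev G" "b \<in> ev G" "f a \<noteq> f b" for a b
      using orth[of a b] that by (cases "a = b") (auto simp: inner_eq_Re_hdot)
    then show "pairwise orthogonal (f ` ev G)"
      by (auto simp: pairwise_def orthogonal_def)
  qed
  ultimately show ?thesis by (rule finite_imageD[rotated])
qed

end

theory Submission
  imports Defs
begin

text \<open>
  The inequality is \<open>\<parallel>S \<chi>\<parallel>\<^sup>2 \<le> \<gamma>\<^sup>2 \<parallel>\<chi>\<parallel>\<^sup>2 - (\<gamma>\<^sup>2 - \<alpha>\<^sup>2) \<langle>\<chi>, \<one>\<rangle>\<^sup>2 / v\<close> for the indicator vector \<open>\<chi>\<close>
  of the subtournament, whose rows contribute at least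
  \<open>\<Sum>i<s. (2 i - (s - 1))\<^sup>2 = s (s\<^sup>2 - 1) / 3\<close> to the left-hand side. To bound \<open>S\<close>, split the
  space into the cyclic subspace generated by \<open>\<one>\<close> and its orthogonal complement, both invariant.
  An eigenvector in the cyclic subspace cannot be orthogonal to \<open>\<one>\<close>, so the norm of \<open>S\<close> there is at
  most \<open>\<alpha>\<close>, while it is at most \<open>\<gamma>\<close> everywhere. No spectral theorem is needed: the norm of a
  self-adjoint map on an invariant subspace is, up to sign, an eigenvalue.
\<close>

section \<open>Self-adjoint maps on invariant subspaces\<close>

lemma nonneg_quadratic_imp_linear_coeff_zero:
  fixes b c :: real
  assumes nn: "\<And>t. 0 \<le> 2 * t * b + t\<^sup>2 * c"
  shows "b = 0"
proof (rule ccontr)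
  assume b: "b \<noteq> 0"
  \<comment> \<open>The test point is \<open>t = - b / d\<close>: once \<open>d > 0\<close> and
    \<open>c < 2 * d\<close>, the quadratic is negative there.\<close>
  define d where "d = \<bar>c\<bar> + 1"
  have d: "d > 0" "c < d" by (auto simp: d_def)
  have "0 \<le> (2 * (- b / d) * b + (- b / d)\<^sup>2 * c) * d\<^sup>2"
    using nn by (rule mult_nonneg_nonneg) simp
  also have "\<dots> = b\<^sup>2 * (c - 2 * d)"
    using d by (simp add: field_simps power2_eq_square)
  also have "\<dots> < 0" using b d by (simp add: mult_pos_neg)
  finally show False by simp
qed

text \<open>By compactness \<open>norm (f z)\<close> attains its maximum \<open>m\<close> at some
  \<open>z\<close> on the unit sphere of \<open>U\<close>. Maximality forces f(f z) = m^2 z, and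
  factoring this as (f - m)(f + m) z = 0 yields an eigenvector for \<open>m\<close> or
  \<open>- m\<close>.\<close>

lemma self_adjoint_norm_eigenvalue:
  fixes f :: "'a::euclidean_space \<Rightarrow> 'a"
  assumes lin: "linear f" and sa: "\<And>x y. f x \<bullet> y = x \<bullet> f y"
    and U: "subspace U" "f ` U \<subseteq> U" "u \<in> U" "u \<noteq> 0"
  obtains m \<theta> x where "m \<ge> 0" "\<theta> = m \<or> \<theta> = - m" "x \<in> U" "x \<noteq> 0" "f x = \<theta> *\<^sub>R x"
    "\<And>y. y \<in> U \<Longrightarrow> norm (f y) \<le> m * norm y"
proof -
  let ?K = "U \<inter> sphere 0 1"
  have "compact ?K" using U(1) by (intro closed_Int_compact closed_subspace) auto
  moreover have "u /\<^sub>R norm u \<in> ?K" using U by (auto intro: subspace_scale)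
  moreover have "continuous_on ?K (\<lambda>x. norm (f x))"
    using lin by (intro continuous_intros linear_continuous_on) (simp add: linear_conv_bounded_linear)
  ultimately obtain z where z: "z \<in> ?K" and zmax: "\<And>y. y \<in> ?K \<Longrightarrow> norm (f y) \<le> norm (f z)"
    using continuous_attains_sup[of ?K "\<lambda>x. norm (f x)"] by blast
  define m where "m = norm (f z)"
  have bound: "norm (f y) \<le> m * norm y" if "y \<in> U" for y
  proof (cases "y = 0")
    case True
    then show ?thesis using lin by (simp add: linear_0)
  next
    case False
    with that U have "y /\<^sub>R norm y \<in> ?K" by (auto intro: subspace_scale)
    from zmax[OF this] show ?thesis
      using False lin by (simp add: linear_scale m_def field_simps)
  qed
  have zU: "z \<in> U" and zz: "z \<bullet> z = 1" using z by (auto simp: dot_square_norm)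
  \<comment> \<open>The residual of the claim f(f z) = m^2 z also serves as the direction of
    perturbation: the linear coefficient below then equals \<open>w \<bullet> w\<close>.\<close>
  define w where "w = m\<^sup>2 *\<^sub>R z - f (f z)"
  have wU: "w \<in> U"
    unfolding w_def using U(1,2) zU by (intro subspace_diff subspace_scale) auto
  text \<open>The form \<open>m\<^sup>2 y\<bullet>y - f y\<bullet>f y\<close> is nonnegative on \<open>U\<close> and vanishes at \<open>z\<close>, so \<open>z\<close> is in its kernel.\<close>
  have "z \<bullet> (m\<^sup>2 *\<^sub>R w - f (f w)) = 0"
  proof (rule nonneg_quadratic_imp_linear_coeff_zero)
    fix t :: real
    let ?y = "z + t *\<^sub>R w"
    have "norm (f ?y) \<le> m * norm ?y"
      using U zU wU by (intro bound subspace_add subspace_scale)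
    then have "(norm (f ?y))\<^sup>2 \<le> (m * norm ?y)\<^sup>2"
      by (intro power_mono) auto
    then have le: "f ?y \<bullet> f ?y \<le> m\<^sup>2 * (?y \<bullet> ?y)"
      by (simp add: power_mult_distrib dot_square_norm)
    have "f z \<bullet> f w = z \<bullet> f (f w)" "f w \<bullet> f z = z \<bullet> f (f w)"
      using sa[of z "f w"] by (simp_all add: inner_commute)
    then have "f ?y \<bullet> f ?y = m\<^sup>2 + 2 * t * (z \<bullet> f (f w)) + t\<^sup>2 * (f w \<bullet> f w)"
      using lin by (simp add: linear_add linear_scale inner_add_left inner_add_right power2_eq_square[of t]
          m_def power2_norm_eq_inner algebra_simps)
    moreover have "?y \<bullet> ?y = 1 + 2 * t * (z \<bullet> w) + t\<^sup>2 * (w \<bullet> w)"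
      using zz by (simp add: inner_add_left inner_add_right power2_eq_square inner_commute algebra_simps)
    ultimately show "0 \<le> 2 * t * (z \<bullet> (m\<^sup>2 *\<^sub>R w - f (f w))) + t\<^sup>2 * (m\<^sup>2 * (w \<bullet> w) - f w \<bullet> f w)"
      using le by (simp add: inner_diff_right algebra_simps)
  qed
  moreover have "z \<bullet> f (f w) = f (f z) \<bullet> w" by (simp only: sa)
  ultimately have "w \<bullet> w = 0"
    by (subst (1) w_def) (simp add: inner_diff_left inner_diff_right)
  then have ffz: "f (f z) = m\<^sup>2 *\<^sub>R z" by (simp add: w_def)
  have m: "m \<ge> 0" by (simp add: m_def)
  show thesis
  \<comment> \<open>Since (f - m)(f + m) z = 0, either (f + m) z vanishes and \<open>z\<close>
    belongs to \<open>- m\<close>, or (f + m) z is itself an eigenvector for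
    \<open>m\<close>.\<close>
  proof (cases "f z + m *\<^sub>R z = 0")
    case True
    then have "f z = (- m) *\<^sub>R z" by (simp add: eq_neg_iff_add_eq_0)
    moreover have "z \<noteq> 0" using zz by auto
    ultimately show thesis using that[of m "- m" z] m zU bound by blast
  next
    case False
    let ?x = "f z + m *\<^sub>R z"
    have "f ?x = m *\<^sub>R ?x"
      using lin by (simp add: linear_add linear_scale ffz power2_eq_square algebra_simps)
    moreover have "?x \<in> U" using U(1,2) zU by (auto intro!: subspace_add subspace_scale)
    ultimately show thesis using that[of m m ?x] m False bound by auto
  qed
qed

lemma cyclic_subspace_invariant:
  fixes f :: "'a::real_vector \<Rightarrow> 'a"
  assumes "linear f"
  shows "f ` span (range (\<lambda>k. (f ^^ k) x)) \<subseteq> span (range (\<lambda>k. (f ^^ k) x))"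
proof -
  have "f ` range (\<lambda>k. (f ^^ k) x) \<subseteq> range (\<lambda>k. (f ^^ k) x)"
  proof clarify
    fix k
    show "f ((f ^^ k) x) \<in> range (\<lambda>k. (f ^^ k) x)"
      by (rule range_eqI[of _ _ "Suc k"]) simp
  qed
  then show ?thesis
    using assms by (simp add: linear_span_image[symmetric] span_mono)
qed

text \<open>Moving powers of \<open>f\<close> onto the eigenvector only rescales it, so
  orthogonality to \<open>e\<close> spreads to the whole cyclic subspace, which contains
  \<open>x\<close> itself.\<close>

lemma cyclic_eigenvector_not_orthogonal:
  fixes f :: "'a::real_inner \<Rightarrow> 'a"
  assumes sa: "\<And>x y. f x \<bullet> y = x \<bullet> f y"
    and x: "x \<in> span (range (\<lambda>k. (f ^^ k) e))" "x \<noteq> 0" "f x = \<theta> *\<^sub>R x"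
  shows "x \<bullet> e \<noteq> 0"
proof
  assume xe: "x \<bullet> e = 0"
  have "x \<bullet> (f ^^ k) e = 0" for k
    by (induction k) (simp_all add: xe sa[symmetric] x(3))
  then have "orthogonal x y" if "y \<in> span (range (\<lambda>k. (f ^^ k) e))" for y
    using that by (rule_tac orthogonal_to_span) (auto simp: orthogonal_def)
  from this[OF x(1)] x(2) show False by (simp add: orthogonal_def)
qed

text \<open>Write x = y + z with y in \<open>U\<close> and z orthogonal to \<open>U\<close>. The
  images stay orthogonal, so the bounds \<open>a\<close> on y and \<open>g\<close> on z add in
  squares. By Cauchy-Schwarz y is at least as long as the projection of x to \<open>e\<close>; the
  factor \<open>e \<bullet> e\<close> clears the denominator.\<close>

lemma self_adjoint_norm_split:
  fixes f :: "'a::euclidean_space \<Rightarrow> 'a"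
  assumes lin: "linear f" and sa: "\<And>x y. f x \<bullet> y = x \<bullet> f y"
    and U: "subspace U" "f ` U \<subseteq> U" "e \<in> U"
    and a: "\<And>y. y \<in> U \<Longrightarrow> norm (f y) \<le> a * norm y"
    and g: "\<And>y. norm (f y) \<le> g * norm y"
    and le: "0 \<le> a" "a \<le> g"
  shows "(e \<bullet> e) * (norm (f x))\<^sup>2 \<le> g\<^sup>2 * (e \<bullet> e) * (x \<bullet> x) - (g\<^sup>2 - a\<^sup>2) * (x \<bullet> e)\<^sup>2"
proof -
  obtain y z where y: "y \<in> span U" and z: "\<And>w. w \<in> span U \<Longrightarrow> orthogonal z w" and x: "x = y + z"
    using orthogonal_subspace_decomp_exists[of U x] by blast
  have sU: "span U = U" using U(1) by (simp add: span_eq_iff)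
  have z0: "z \<bullet> w = 0" if "w \<in> U" for w
    using z that sU by (auto simp: orthogonal_def)
  have yU: "y \<in> U" "f (f y) \<in> U" using y sU U(2) by auto
  have "f z \<bullet> f y = 0" using z0[OF yU(2)] by (simp add: sa)
  then have fx: "(norm (f x))\<^sup>2 = (norm (f y))\<^sup>2 + (norm (f z))\<^sup>2"
    using lin by (simp add: x linear_add dot_square_norm[symmetric] inner_add_left inner_add_right
        inner_commute)
  have xx: "x \<bullet> x = y \<bullet> y + z \<bullet> z"
    using z0[OF yU(1)] by (simp add: x inner_add_left inner_add_right inner_commute)
  have "(norm (f y))\<^sup>2 \<le> (a * norm y)\<^sup>2" "(norm (f z))\<^sup>2 \<le> (g * norm z)\<^sup>2"
    using a[OF yU(1)] g[of z] by (auto intro: power_mono)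
  then have "(norm (f x))\<^sup>2 \<le> a\<^sup>2 * (y \<bullet> y) + g\<^sup>2 * (z \<bullet> z)"
    by (simp add: fx power_mult_distrib dot_square_norm)
  also have "\<dots> = g\<^sup>2 * (x \<bullet> x) - (g\<^sup>2 - a\<^sup>2) * (y \<bullet> y)"
    by (simp add: xx algebra_simps)
  finally have 1: "(e \<bullet> e) * (norm (f x))\<^sup>2
      \<le> (e \<bullet> e) * (g\<^sup>2 * (x \<bullet> x) - (g\<^sup>2 - a\<^sup>2) * (y \<bullet> y))"
    by (rule mult_left_mono) simp
  have "x \<bullet> e = y \<bullet> e" using z0[OF U(3)] by (simp add: x inner_add_left)
  then have "(x \<bullet> e)\<^sup>2 \<le> (y \<bullet> y) * (e \<bullet> e)"
    using Cauchy_Schwarz_ineq[of y e] by simp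
  then have "(g\<^sup>2 - a\<^sup>2) * (x \<bullet> e)\<^sup>2 \<le> (g\<^sup>2 - a\<^sup>2) * ((y \<bullet> y) * (e \<bullet> e))"
    using le by (intro mult_left_mono) (auto intro: power_mono)
  with 1 show ?thesis by (simp add: algebra_simps)
qed

section \<open>The Seidel matrix\<close>

lemma scaleR_eq_smult: "c *\<^sub>R x = complex_of_real c *s x" for x :: "complex^'n"
  by (simp add: vec_eq_iff scaleR_conv_of_real[where 'a=complex])

lemma linear_seidel: "linear ((*v) (seidel_matrix G))"
  by (rule linearI) (simp_all add: matrix_vector_right_distrib scaleR_eq_smult vec.scale)

lemma seidel_self_adjoint: "(seidel_matrix G *v x) \<bullet> y = x \<bullet> (seidel_matrix G *v y)"
  by (simp add: inner_eq_Re_hdot hdot_matrix seidel_hermitian)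

text \<open>The eigenprojection fixes \<open>x\<close> and is Hermitian, so it can be moved onto the
  all-one vector, whose image is therefore nonzero.\<close>

lemma main_evI:
  fixes G :: "'v::finite pair_pre_digraph"
  assumes x: "seidel_matrix G *v x = \<theta> *\<^sub>R x" and "x \<bullet> (\<chi> i. 1) \<noteq> 0"
  shows "\<theta> \<in> main_ev G"
proof -
  let ?P = "eigenprojection G \<theta>"
  have P: "is_orthogonal_projection (eigenspace (seidel_matrix G) (complex_of_real \<theta>)) ?P"
    by (rule eigenprojection_is_orthogonal_projection)
  have "x \<in> range ((*v) ?P)"
    using P x by (simp add: is_orthogonal_projection_def eigenspace_def scaleR_eq_smult)
  then obtain y where "x = ?P *v y" by blast
  then have "?P *v x = x"
    using P by (simp add: is_orthogonal_projection_def matrix_vector_mul_assoc)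
  then have "x \<bullet> (\<chi> i. 1) = x \<bullet> (?P *v (\<chi> i. 1))"
    using P hdot_matrix[of ?P x "\<chi> i. 1"]
    by (simp add: inner_eq_Re_hdot is_orthogonal_projection_def)
  with assms(2) have "?P *v (\<chi> i. 1) \<noteq> 0" by auto
  moreover have "\<theta> \<in> ev G"
    using x assms(2) unfolding ev_def eigenvalue_def scaleR_eq_smult by (auto intro!: exI[of _ x])
  ultimately show ?thesis by (simp add: main_ev_def main_angle_def)
qed

text \<open>\<open>S\<close> is \<open>\<i>\<close> times a real matrix, so conjugation turns an eigenvector for \<open>\<theta>\<close> into one for \<open>-\<theta>\<close>.\<close>

lemma seidel_cnj_eigenvector:
  assumes "seidel_matrix G *v x = \<theta> *\<^sub>R x"
  shows "seidel_matrix G *v (\<chi> i. cnj (x $ i)) = (- \<theta>) *\<^sub>R (\<chi> i. cnj (x $ i))"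
proof -
  have S: "cnj (seidel_matrix G $ i $ j) = - (seidel_matrix G $ i $ j)" for i j
    by (simp add: seidel_matrix_def adjacency_matrix_def adjacency_def transpose_def)
  have "(seidel_matrix G *v (\<chi> i. cnj (x $ i))) $ i = - cnj ((seidel_matrix G *v x) $ i)" for i
    by (simp add: matrix_vector_mult_def S sum_negf)
  with assms show ?thesis by (simp add: vec_eq_iff)
qed

lemma ev_uminus: "- \<theta> \<in> ev G" if "\<theta> \<in> ev G"
proof -
  from that obtain x where x: "x \<noteq> 0" "seidel_matrix G *v x = \<theta> *\<^sub>R x"
    by (auto simp: ev_def eigenvalue_def scaleR_eq_smult)
  from x(1) have "(\<chi> i. cnj (x $ i)) \<noteq> 0" by (simp add: vec_eq_iff)
  with seidel_cnj_eigenvector[OF x(2)] show ?thesis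
    unfolding ev_def eigenvalue_def scaleR_eq_smult by blast
qed

section \<open>Norm of the Seidel matrix on the whole space and on the cyclic subspace of the
  all-one vector\<close>

lemma seidel_norm_bound:
  fixes G :: "'v::finite pair_pre_digraph"
  obtains m where "m \<in> ev G" "m \<ge> 0" "\<And>y. norm (seidel_matrix G *v y) \<le> m * norm y"
proof -
  have ne: "((\<chi> i. 1) :: complex^'v) \<noteq> 0" by (simp add: vec_eq_iff)
  obtain m \<theta> x where m: "m \<ge> 0" "\<theta> = m \<or> \<theta> = - m" "x \<noteq> 0" "seidel_matrix G *v x = \<theta> *\<^sub>R x"
    "\<And>y. norm (seidel_matrix G *v y) \<le> m * norm y"
    by (rule self_adjoint_norm_eigenvalue[OF linear_seidel seidel_self_adjoint _ _ _ ne, of UNIV G])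
      auto
  then have "\<theta> \<in> ev G" by (auto simp: ev_def eigenvalue_def scaleR_eq_smult)
  with m(2) ev_uminus[of \<theta> G] have "m \<in> ev G" by auto
  with m show thesis using that by blast
qed

lemma seidel_cyclic_norm_bound:
  fixes G :: "'v::finite pair_pre_digraph"
  defines "U \<equiv> span (range (\<lambda>k. ((*v) (seidel_matrix G) ^^ k) (\<chi> i. 1)))"
  obtains m where "m \<in> main_ev G" "m \<ge> 0"
    "\<And>y. y \<in> U \<Longrightarrow> norm (seidel_matrix G *v y) \<le> m * norm y"
proof -
  let ?e = "(\<chi> i. 1) :: complex^'v"
  have ne: "?e \<noteq> 0" by (simp add: vec_eq_iff)
  have eU: "?e \<in> U"
    unfolding U_def by (intro span_base range_eqI[of _ _ 0]) simp
  have inv: "(*v) (seidel_matrix G) ` U \<subseteq> U"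
    unfolding U_def by (rule cyclic_subspace_invariant[OF linear_seidel])
  have sub: "subspace U" by (simp add: U_def)
  obtain m \<theta> x where m: "m \<ge> 0" "\<theta> = m \<or> \<theta> = - m" "x \<in> U" "x \<noteq> 0"
    "seidel_matrix G *v x = \<theta> *\<^sub>R x" "\<And>y. y \<in> U \<Longrightarrow> norm (seidel_matrix G *v y) \<le> m * norm y"
    by (rule self_adjoint_norm_eigenvalue[OF linear_seidel seidel_self_adjoint sub inv eU ne]) blast
  have xe: "x \<bullet> ?e \<noteq> 0"
    using cyclic_eigenvector_not_orthogonal[OF seidel_self_adjoint m(3)[unfolded U_def] m(4,5)] .
  \<comment> \<open>The real inner product with the all-one vector sums real parts, which
    conjugation preserves. Hence both signs of \<open>\<theta>\<close> are main eigenvalues, and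
    \<open>m\<close> is one of them.\<close>
  then have "(\<chi> i. cnj (x $ i)) \<bullet> ?e \<noteq> 0"
    by (simp add: inner_vec_def inner_complex_def)
  with main_evI[OF m(5) xe] main_evI[OF seidel_cnj_eigenvector[OF m(5)]] m(2)
  have "m \<in> main_ev G" by auto
  with m show thesis using that by blast
qed

lemma seidel_quadratic_bound:
  fixes G :: "'v::finite pair_pre_digraph"
  assumes ne: "ev G - main_ev G \<noteq> {}"
    and \<alpha>: "\<alpha> = Max (main_ev G)" and \<gamma>: "\<gamma> = Max (ev G - main_ev G)" and le: "\<alpha> \<le> \<gamma>"
  shows "real CARD('v) * (norm (seidel_matrix G *v x))\<^sup>2
    \<le> \<gamma>\<^sup>2 * real CARD('v) * (x \<bullet> x) - (\<gamma>\<^sup>2 - \<alpha>\<^sup>2) * (x \<bullet> (\<chi> i. 1))\<^sup>2"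
proof -
  let ?S = "(*v) (seidel_matrix G)"
  let ?e = "(\<chi> i. 1) :: complex^'v"
  let ?U = "span (range (\<lambda>k. (?S ^^ k) ?e))"
  have fin: "finite (main_ev G)" "finite (ev G - main_ev G)"
    using finite_ev[of G] by (auto simp: main_ev_def)
  obtain a where a: "a \<in> main_ev G" "a \<ge> 0" "\<And>y. y \<in> ?U \<Longrightarrow> norm (?S y) \<le> a * norm y"
    using seidel_cyclic_norm_bound[of G] by blast
  obtain g where g: "g \<in> ev G" "g \<ge> 0" "\<And>y. norm (?S y) \<le> g * norm y"
    using seidel_norm_bound[of G] by blast
  have "a \<le> \<alpha>" using a(1) fin by (simp add: \<alpha>)
  \<comment> \<open>The norm \<open>g\<close> may itself be a main eigenvalue; then it is at most
    \<open>\<alpha>\<close>, and \<open>\<alpha> \<le> \<gamma>\<close> closes the gap.\<close>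
  have "g \<le> \<gamma>"
  proof (cases "g \<in> main_ev G")
    case True
    then have "g \<le> \<alpha>" using fin by (simp add: \<alpha>)
    with le show ?thesis by simp
  next
    case False
    with g fin show ?thesis by (simp add: \<gamma>)
  qed
  have ee: "?e \<bullet> ?e = real CARD('v)" by (simp add: inner_vec_def)
  show ?thesis
    unfolding ee[symmetric]
  proof (rule self_adjoint_norm_split[OF linear_seidel seidel_self_adjoint, where U = ?U])
    show "?S ` ?U \<subseteq> ?U" by (rule cyclic_subspace_invariant[OF linear_seidel])
    show "?e \<in> ?U" by (intro span_base range_eqI[of _ _ 0]) simp
    show "norm (?S y) \<le> \<alpha> * norm y" if "y \<in> ?U" for y
      using a(3)[OF that] \<open>a \<le> \<alpha>\<close> by (meson mult_right_mono norm_ge_zero order_trans)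
    show "norm (?S y) \<le> \<gamma> * norm y" for y
      using g(3)[of y] \<open>g \<le> \<gamma>\<close> by (meson mult_right_mono norm_ge_zero order_trans)
  qed (use a(2) \<open>a \<le> \<alpha>\<close> le in auto)
qed

section \<open>Transitive tournaments\<close>

text \<open>Along an arc from x to y the out-neighbourhood strictly shrinks: transitivity gives
  inclusion, and y lies in that of x but not in its own. Totality makes the degrees distinct, and
  all are below \<open>card V\<close>.\<close>

lemma bij_betw_strict_order_degree:
  assumes fin: "finite V" and tr: "trans R" and irr: "\<And>x. x \<in> V \<Longrightarrow> (x, x) \<notin> R"
    and tot: "\<And>x y. x \<in> V \<Longrightarrow> y \<in> V \<Longrightarrow> x \<noteq> y \<Longrightarrow> (x, y) \<in> R \<or> (y, x) \<in> R"
  shows "bij_betw (\<lambda>x. card {y \<in> V. (x, y) \<in> R}) V {..<card V}"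
proof -
  let ?d = "\<lambda>x. card {y \<in> V. (x, y) \<in> R}"
  have less: "?d y < ?d x" if "x \<in> V" "y \<in> V" "(x, y) \<in> R" for x y
    using fin that irr[of y] tr by (intro psubset_card_mono) (auto dest: transD)
  have inj: "inj_on ?d V"
  proof (rule inj_onI, rule ccontr)
    fix x y assume "x \<in> V" "y \<in> V" "?d x = ?d y" "x \<noteq> y"
    then show False using less[of x y] less[of y x] tot[of x y] by auto
  qed
  have "?d x < card V" if "x \<in> V" for x
    using fin that irr[of x] by (intro psubset_card_mono) auto
  then have "?d ` V = {..<card V}"
    using inj by (intro card_subset_eq) (auto simp: card_image)
  with inj show ?thesis by (simp add: bij_betw_def)
qed

text \<open>The centre \<open>c\<close> is independent of \<open>n\<close> so that the induction
  goes through; the value used later is c = n - 1.\<close>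

lemma sum_centered_squares:
  "(\<Sum>i<n. (2 * real i - c)\<^sup>2) = real n * (4 * (real n)\<^sup>2 - 6 * real n + 2) / 3
     - 2 * c * real n * (real n - 1) + real n * c\<^sup>2"
  by (induction n) (simp_all add: field_simps power2_eq_square)

lemma sum_scores_transitive_tournament:
  assumes T: "transitive_tournament \<Gamma>"
  shows "(\<Sum>x\<in>pverts \<Gamma>. (real (card {y \<in> pverts \<Gamma>. (x, y) \<in> parcs \<Gamma>})
           - real (card {y \<in> pverts \<Gamma>. (y, x) \<in> parcs \<Gamma>}))\<^sup>2)
         = real (card (pverts \<Gamma>)) * ((real (card (pverts \<Gamma>)))\<^sup>2 - 1) / 3"
proof -
  define V where "V = pverts \<Gamma>"
  define R where "R = parcs \<Gamma>"
  have fin: "finite V"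
    using T by (simp add: transitive_tournament_def tournament_def V_def pair_fin_digraph.pair_finite_verts)
  have tr: "trans R" using T by (simp add: transitive_tournament_def R_def)
  have adj: "(if (x, y) \<in> R then 1 else 0) + (if (y, x) \<in> R then 1 else 0)
      = (1 - (if x = y then 1 else 0) :: complex)" if "x \<in> V" "y \<in> V" for x y
    using T that by (simp add: transitive_tournament_def tournament_def adjacency_def V_def R_def)
  have irr: "(x, x) \<notin> R" if "x \<in> V" for x
    using adj[OF that that] by (auto split: if_splits)
  have tot: "(x, y) \<in> R \<or> (y, x) \<in> R" if "x \<in> V" "y \<in> V" "x \<noteq> y" for x y
    using adj[OF that(1,2)] that(3) by (auto split: if_splits)
  have asym: "(y, x) \<notin> R" if "x \<in> V" "y \<in> V" "(x, y) \<in> R" for x y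
    using adj[OF that(1,2)] that(3) by (auto split: if_splits)
  let ?d = "\<lambda>x. card {y \<in> V. (x, y) \<in> R}"
  have bij: "bij_betw ?d V {..<card V}"
    using fin tr irr tot by (rule bij_betw_strict_order_degree)
  \<comment> \<open>Each other vertex is either an out-neighbour or an in-neighbour of
    \<open>x\<close>, never both, so the difference of the degrees is twice the out-degree minus (n
    - 1), where n = \<open>card V\<close>.\<close>
  have ind: "real (card {y \<in> V. (y, x) \<in> R}) = real (card V) - 1 - real (?d x)" if "x \<in> V" for x
  proof -
    have "V = insert x ({y \<in> V. (x, y) \<in> R} \<union> {y \<in> V. (y, x) \<in> R})"
      using that tot by blast
    also have "card \<dots> = Suc (card ({y \<in> V. (x, y) \<in> R} \<union> {y \<in> V. (y, x) \<in> R}))"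
      using fin irr that by (subst card_insert_disjoint) auto
    also have "card ({y \<in> V. (x, y) \<in> R} \<union> {y \<in> V. (y, x) \<in> R}) = ?d x + card {y \<in> V. (y, x) \<in> R}"
      using fin that by (intro card_Un_disjoint) (auto dest: asym)
    finally show ?thesis by simp
  qed
  have "(\<Sum>x\<in>V. (real (?d x) - real (card {y \<in> V. (y, x) \<in> R}))\<^sup>2)
      = (\<Sum>x\<in>V. (2 * real (?d x) - (real (card V) - 1))\<^sup>2)"
    by (rule sum.cong) (simp_all add: ind algebra_simps)
  also have "\<dots> = (\<Sum>i<card V. (2 * real i - (real (card V) - 1))\<^sup>2)"
    by (rule sum.reindex_bij_betw[OF bij])
  also have "\<dots> = real (card V) * ((real (card V))\<^sup>2 - 1) / 3"
    by (subst sum_centered_squares) (simp add: field_simps power2_eq_square)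
  finally show ?thesis by (simp add: V_def R_def)
qed

text \<open>At a vertex of \<open>\<Gamma>\<close> the image of the indicator vector is the
  imaginary unit times out-degree minus in-degree within \<open>\<Gamma>\<close>. The remaining
  coordinates are only bounded below by 0.\<close>

lemma transitive_subtournament_norm_bound:
  fixes G \<Gamma> :: "'v::finite pair_pre_digraph"
  assumes "transitive_subtournament \<Gamma> G" and s: "s = card (pverts \<Gamma>)"
  shows "real s * ((real s)\<^sup>2 - 1) / 3
    \<le> (norm (seidel_matrix G *v (\<chi> i. if i \<in> pverts \<Gamma> then 1 else 0)))\<^sup>2"
proof -
  let ?V = "pverts \<Gamma>"
  let ?x = "(\<chi> i. if i \<in> ?V then 1 else 0) :: complex^'v"
  have T: "transitive_tournament \<Gamma>" and ind: "induced_subgraph (with_proj \<Gamma>) (with_proj G)"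
    using assms by (auto simp: transitive_subtournament_def)
  have arcs: "(x, y) \<in> parcs G \<longleftrightarrow> (x, y) \<in> parcs \<Gamma>" if "x \<in> ?V" "y \<in> ?V" for x y
    using ind that by (auto simp: induced_subgraph_def)
  have entry: "(seidel_matrix G *v ?x) $ i
      = \<i> * complex_of_real (real (card {j \<in> ?V. (i, j) \<in> parcs \<Gamma>})
          - real (card {j \<in> ?V. (j, i) \<in> parcs \<Gamma>}))" if i: "i \<in> ?V" for i
  proof -
    have "(seidel_matrix G *v ?x) $ i = (\<Sum>j\<in>UNIV. if j \<in> ?V then seidel_matrix G $ i $ j else 0)"
      by (simp add: matrix_vector_mult_def if_distrib cong: if_cong)
    also have "\<dots> = (\<Sum>j\<in>?V. seidel_matrix G $ i $ j)"
      by (simp add: sum.If_cases)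
    also have "\<dots> = (\<Sum>j\<in>?V. \<i> * ((if (i, j) \<in> parcs \<Gamma> then 1 else 0) - (if (j, i) \<in> parcs \<Gamma> then 1 else 0)))"
      using i by (intro sum.cong)
        (simp_all add: seidel_matrix_def adjacency_matrix_def adjacency_def transpose_def arcs)
    also have "\<dots> = \<i> * ((\<Sum>j\<in>?V. if (i, j) \<in> parcs \<Gamma> then 1 else 0) - (\<Sum>j\<in>?V. if (j, i) \<in> parcs \<Gamma> then 1 else 0))"
      by (simp only: sum_distrib_left[symmetric] sum_subtractf)
    finally show ?thesis
      by (simp add: sum.If_cases Int_def)
  qed
  have "real s * ((real s)\<^sup>2 - 1) / 3 = (\<Sum>i\<in>?V. (norm ((seidel_matrix G *v ?x) $ i))\<^sup>2)"
    unfolding s sum_scores_transitive_tournament[OF T, symmetric]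
    by (rule sum.cong) (simp_all only: entry norm_mult norm_of_real norm_ii mult_1 power2_abs)
  also have "\<dots> \<le> (\<Sum>i\<in>UNIV. (norm ((seidel_matrix G *v ?x) $ i))\<^sup>2)"
    by (rule sum_mono2) auto
  also have "\<dots> = (norm (seidel_matrix G *v ?x))\<^sup>2"
    by (simp add: norm_vec_def L2_set_def sum_nonneg)
  finally show ?thesis .
qed

section \<open>From the two norm bounds to a quadratic inequality in \<open>s\<close>\<close>

theorem theorem4p3:
  fixes G \<Gamma> :: "'v::finite pair_pre_digraph"
    and v s :: nat
    and \<alpha> \<gamma> :: real
  assumes "pair_fin_digraph G" and "pverts G = UNIV" and "v = card (pverts G)"
    and "transitive_subtournament \<Gamma> G" and "s = card (pverts \<Gamma>)"
    and "ev G - main_ev G \<noteq> {}"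
    and "\<alpha> = Max (main_ev G)" and "\<gamma> = Max (ev G - main_ev G)"
    and "\<alpha> \<le> \<gamma>"
  shows "real s \<le> (3 * \<alpha>\<^sup>2 - 3 * \<gamma>\<^sup>2
            + sqrt (4 * (real v)\<^sup>2 * (1 + 3 * \<gamma>\<^sup>2) + 9 * (\<gamma>\<^sup>2 - \<alpha>\<^sup>2)\<^sup>2)) / (2 * real v)"
proof -
  let ?x = "(\<chi> i. if i \<in> pverts \<Gamma> then 1 else 0) :: complex^'v"
  define c where "c = \<gamma>\<^sup>2 - \<alpha>\<^sup>2"
  have v: "v = CARD('v)" using assms by simp
  then have vpos: "real v > 0" by simp
  have card: "(\<Sum>i\<in>UNIV. if i \<in> pverts \<Gamma> then 1 else 0) = real s"
    by (simp add: sum.If_cases assms(5))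
  have xx: "?x \<bullet> ?x = real s" and xe: "?x \<bullet> (\<chi> i. 1) = real s"
    unfolding card[symmetric] inner_vec_def by (rule sum.cong; simp)+
  have "real v * (real s * ((real s)\<^sup>2 - 1) / 3) \<le> real v * (norm (seidel_matrix G *v ?x))\<^sup>2"
    by (intro mult_left_mono transitive_subtournament_norm_bound assms) simp
  also have "\<dots> \<le> \<gamma>\<^sup>2 * real v * real s - c * (real s)\<^sup>2"
    using seidel_quadratic_bound[OF assms(6-9), of ?x] by (simp only: v xx xe c_def)
  finally have "real s * (real v * (real s)\<^sup>2 + 3 * c * real s)
      \<le> real s * (real v * (1 + 3 * \<gamma>\<^sup>2))"
    by (simp add: field_simps power2_eq_square)
  then have quad: "real v * (real s)\<^sup>2 + 3 * c * real s \<le> real v * (1 + 3 * \<gamma>\<^sup>2)"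
    by (cases "s = 0") auto
  \<comment> \<open>Completing the square: \<open>quad\<close> is multiplied by 4v and 9c^2 is
    added, so the bound obtained for \<open>s\<close> is the larger root of the quadratic.\<close>
  have "(2 * real v * real s + 3 * c)\<^sup>2 = 4 * real v * (real v * (real s)\<^sup>2 + 3 * c * real s) + 9 * c\<^sup>2"
    by (simp add: power2_eq_square algebra_simps)
  also have "\<dots> \<le> 4 * real v * (real v * (1 + 3 * \<gamma>\<^sup>2)) + 9 * c\<^sup>2"
    using quad by (intro add_right_mono mult_left_mono) auto
  also have "\<dots> = 4 * (real v)\<^sup>2 * (1 + 3 * \<gamma>\<^sup>2) + 9 * c\<^sup>2"
    by (simp add: power2_eq_square)
  finally have "2 * real v * real s + 3 * c \<le> sqrt (4 * (real v)\<^sup>2 * (1 + 3 * \<gamma>\<^sup>2) + 9 * c\<^sup>2)"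
    by (rule real_le_rsqrt)
  with vpos show ?thesis
    by (simp add: c_def pos_le_divide_eq algebra_simps)
qed

end
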